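(* Let $\varepsilon>0$, let $x_1<\cdots<x_N$ and $y_1<\cdots<y_N$ be real numbers, and let $K=[e^{-|x_i-y_j|/\varepsilon}]\in\mathbb{R}^{N\times N}$. Let $\zeta$ be the dividing index, and let $K_L,K_U$, $r_i,\boldsymbol\eta_i$, $r'_i,\boldsymbol\eta'_i$ be as defined in the context. For $\boldsymbol\psi=(\psi_1,\dots,\psi_N)^\top\in\mathbb{R}^N$ put $\boldsymbol\psi_i=[\psi_{\zeta(i-1)+1},\dots,\psi_{\zeta(i)}]^\top$ and $\boldsymbol\psi'_i=[\psi_{\zeta(i)+1},\dots,\psi_{\zeta(i+1)}]^\top$ for $i=1,\dots,N$ (with $\zeta(0)=0$, $\zeta(N+1)=N$). Then $K\boldsymbol\psi=\boldsymbol p+\boldsymbol q$, where $\boldsymbol p=K_L\boldsymbol\psi$ and $\boldsymbol q=K_U\boldsymbol\psi$ satisfy the recursions $$p_1=\boldsymbol\eta_1\cdot\boldsymbol\psi_1,\qquad p_{i+1}=r_ip_i+\boldsymbol\eta_{i+1}\cdot\boldsymbol\psi_{i+1}\quad(i=1,\dots,N-1),$$ $$q_N=\boldsymbol\eta'_N\cdot\boldsymbol\psi'_N,\qquad q_i=r'_iq_{i+1}+\boldsymbol\eta'_i\cdot\boldsymbol\psi'_i\quad(i=N-1,\dots,1).$$ Consequently, given $\zeta$ and the vectors $(r_i),(\boldsymbol\eta_i),(r'_i),(\boldsymbol\eta'_i)$, the matrix-vector multiplication $K\boldsymbol\psi$ requires no more than $3N+\zeta(N)-\zeta(1)-2<4N$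 multiplications and no more than $2N+\zeta(N)-\zeta(1)-2<3N$ additions (the additions needed to form the sum $\boldsymbol p+\boldsymbol q$ being included), and hence $O(N)$ operations.
   Context: The dividing index is the map $\zeta:\{1,\dots,N\}\to\{0,1,\dots,N\}$ defined as follows: if $y_1\le x_i<y_N$, then $\zeta(i)$ is the unique index with $y_{\zeta(i)}\le x_i<y_{\zeta(i)+1}$; if $x_i<y_1$, then $\zeta(i)=0$; if $x_i\ge y_N$, then $\zeta(i)=N$. Conventions: $\zeta(0)=0$ and $\zeta(N+1)=N$. The lower block $K_L=[\check k_{ij}]$ and upper block $K_U=[\hat k_{ij}]$ of $K$, both in $\mathbb{R}^{N\times N}$, are: $\check k_{ij}=K_{ij}=e^{-(x_i-y_j)/\varepsilon}$ for $1\le j\le\zeta(i)$ and $\check k_{ij}=0$ for $\zeta(i)<j\le N$; $\hat k_{ij}=0$ for $1\le j\le\zeta(i)$ and $\hat k_{ij}=K_{ij}=e^{-(y_j-x_i)/\varepsilon}$ for $\zeta(i)<j\le N$. Ratio vectors: for $i=1,\dots,N-1$, $r_i=\check k_{i+1,1}/\check k_{i,1}$ (and $r_i=1$ if $\check k_{i,1}=0$), $r'_i=\hat k_{i,N}/\hat k_{i+1,N}$ (and $r'_i=1$ if $\hat k_{i+1,N}=0$). Block-edge vectors: for $i=1,\dots,N$, $\boldsymbol\eta_i=[\check k_{i,\zeta(i-1)+1},\dots,\check k_{i,\zeta(i)}]$ and $\boldsymbol\eta'_i=[\hat k_{i,\zeta(i)+1},\dots,\hat k_{i,\zeta(i+1)}]$,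 where a vector is empty (dimension zero) if its index range is empty. The dot $\cdot$ denotes the sum of products of corresponding entries; a dot product of empty vectors is $0$. *)

theory Defs
  imports Complex_Main "HOL-Library.ListVector" "HOL-Library.Landau_Symbols"
begin

text \<open>
  Vectors in \<open>\<real>\<^sup>N\<close> and \<open>N \<times> N\<close> matrices are functions on \<open>nat\<close>, resp. \<open>nat \<times> nat\<close> (curried), of which
  only the indices \<open>1, \<dots>, N\<close> matter. Vectors whose dimension depends on the dividing index
  (possibly zero) are lists; their dot product is \<^const>\<open>iprod\<close>.
\<close>

definition exp_kernel :: "real \<Rightarrow> (nat \<Rightarrow> real) \<Rightarrow> (nat \<Rightarrow> real) \<Rightarrow> nat \<Rightarrow> nat \<Rightarrow> real" where
  "exp_kernel \<epsilon> x y i j = exp (- \<bar>x i - y j\<bar> / \<epsilon>)"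

definition mat_vec :: "nat \<Rightarrow> (nat \<Rightarrow> nat \<Rightarrow> real) \<Rightarrow> (nat \<Rightarrow> real) \<Rightarrow> nat \<Rightarrow> real" where
  "mat_vec N A v i = (\<Sum>j = 1..N. A i j * v j)"

text \<open>The first two cases are the conventions \<open>\<zeta>(0) = 0\<close> and \<open>\<zeta>(N + 1) = N\<close>.\<close>

definition zeta :: "nat \<Rightarrow> (nat \<Rightarrow> real) \<Rightarrow> (nat \<Rightarrow> real) \<Rightarrow> nat \<Rightarrow> nat" where
  "zeta N x y i =
     (if i = 0 then 0
      else if i > N then N
      else if x i < y 1 then 0
      else if x i \<ge> y N then N
      else (THE k. k \<in> {1..<N} \<and> y k \<le> x i \<and> x i < y (k + 1)))"

definition lower_block ::
    "nat \<Rightarrow> real \<Rightarrow> (nat \<Rightarrow> real) \<Rightarrow> (nat \<Rightarrow> real) \<Rightarrow> nat \<Rightarrow> nat \<Rightarrow> real" where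
  "lower_block N \<epsilon> x y i j = (if j \<le> zeta N x y i then exp_kernel \<epsilon> x y i j else 0)"

definition upper_block ::
    "nat \<Rightarrow> real \<Rightarrow> (nat \<Rightarrow> real) \<Rightarrow> (nat \<Rightarrow> real) \<Rightarrow> nat \<Rightarrow> nat \<Rightarrow> real" where
  "upper_block N \<epsilon> x y i j = (if j \<le> zeta N x y i then 0 else exp_kernel \<epsilon> x y i j)"

definition ratio :: "nat \<Rightarrow> real \<Rightarrow> (nat \<Rightarrow> real) \<Rightarrow> (nat \<Rightarrow> real) \<Rightarrow> nat \<Rightarrow> real" where
  "ratio N \<epsilon> x y i =
     (if lower_block N \<epsilon> x y i 1 = 0 then 1
      else lower_block N \<epsilon> x y (i + 1) 1 / lower_block N \<epsilon> x y i 1)"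

definition ratio' :: "nat \<Rightarrow> real \<Rightarrow> (nat \<Rightarrow> real) \<Rightarrow> (nat \<Rightarrow> real) \<Rightarrow> nat \<Rightarrow> real" where
  "ratio' N \<epsilon> x y i =
     (if upper_block N \<epsilon> x y (i + 1) N = 0 then 1
      else upper_block N \<epsilon> x y i N / upper_block N \<epsilon> x y (i + 1) N)"

text \<open>\<open>slice v a b\<close> is the vector \<open>[v\<^bsub>a+1\<^esub>, \<dots>, v\<^bsub>b\<^esub>]\<close>, empty if \<open>b \<le> a\<close>.\<close>

definition slice :: "(nat \<Rightarrow> real) \<Rightarrow> nat \<Rightarrow> nat \<Rightarrow> real list" where
  "slice v a b = map v [a + 1..<b + 1]"

definition edge :: "nat \<Rightarrow> real \<Rightarrow> (nat \<Rightarrow> real) \<Rightarrow> (nat \<Rightarrow> real) \<Rightarrow> nat \<Rightarrow> real list" where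
  "edge N \<epsilon> x y i = slice (lower_block N \<epsilon> x y i) (zeta N x y (i - 1)) (zeta N x y i)"

definition edge' :: "nat \<Rightarrow> real \<Rightarrow> (nat \<Rightarrow> real) \<Rightarrow> (nat \<Rightarrow> real) \<Rightarrow> nat \<Rightarrow> real list" where
  "edge' N \<epsilon> x y i = slice (upper_block N \<epsilon> x y i) (zeta N x y i) (zeta N x y (i + 1))"

text \<open>
  Operation counts refer to straight-line programs whose only operations are binary additions and
  multiplications and which have no constants. The \<open>m\<close>-th instruction (counting from 0) writes
  register \<open>m\<close>, and may read inputs and earlier registers, so that intermediate results are shared.
\<close>

datatype 'v operand = Input 'v | Reg nat

datatype 'v instr =
    is_Add: Add "'v operand" "'v operand"
  | is_Mult: Mult "'v operand" "'v operand"

datatype 'v slp = SLP (code: "'v instr list") (outputs: "'v operand list")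

primrec operand_val :: "('v \<Rightarrow> real) \<Rightarrow> real list \<Rightarrow> 'v operand \<Rightarrow> real" where
  "operand_val inp regs (Input v) = inp v"
| "operand_val inp regs (Reg k) = regs ! k"

primrec instr_val :: "('v \<Rightarrow> real) \<Rightarrow> real list \<Rightarrow> 'v instr \<Rightarrow> real" where
  "instr_val inp regs (Add a b) = operand_val inp regs a + operand_val inp regs b"
| "instr_val inp regs (Mult a b) = operand_val inp regs a * operand_val inp regs b"

primrec operands :: "'v instr \<Rightarrow> 'v operand set" where
  "operands (Add a b) = {a, b}"
| "operands (Mult a b) = {a, b}"

definition registers :: "('v \<Rightarrow> real) \<Rightarrow> 'v instr list \<Rightarrow> real list" where
  "registers inp is = foldl (\<lambda>regs c. regs @ [instr_val inp regs c]) [] is"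

definition slp_result :: "('v \<Rightarrow> real) \<Rightarrow> 'v slp \<Rightarrow> real list" where
  "slp_result inp P = map (operand_val inp (registers inp (code P))) (outputs P)"

text \<open>Well-formedness relative to a set \<open>V\<close> of readable inputs.\<close>

definition wf_slp :: "'v set \<Rightarrow> 'v slp \<Rightarrow> bool" where
  "wf_slp V P \<longleftrightarrow>
     (\<forall>m < length (code P). operands (code P ! m) \<subseteq> Input ` V \<union> Reg ` {..<m}) \<and>
     set (outputs P) \<subseteq> Input ` V \<union> Reg ` {..<length (code P)}"

definition num_mults :: "'v slp \<Rightarrow> nat" where
  "num_mults P = length (filter is_Mult (code P))"

definition num_adds :: "'v slp \<Rightarrow> nat" where
  "num_adds P = length (filter is_Add (code P))"

text \<open>
  The data available to the multiplication. Edge entries are addressed by the number of the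
  block-edge vector and the (0-based) position in it.
\<close>

datatype datum = Ratio nat | Ratio' nat | Edge nat nat | Edge' nat nat | Psi nat

text \<open>The available data depend only on \<open>N\<close> and on the dividing index \<open>z\<close>.\<close>

definition data :: "nat \<Rightarrow> (nat \<Rightarrow> nat) \<Rightarrow> datum set" where
  "data N z =
     Ratio ` {1..<N} \<union> Ratio' ` {1..<N} \<union>
     {Edge i k | i k. i \<in> {1..N} \<and> k < z i - z (i - 1)} \<union>
     {Edge' i k | i k. i \<in> {1..N} \<and> k < z (i + 1) - z i} \<union>
     Psi ` {1..N}"

primrec data_val ::
    "nat \<Rightarrow> real \<Rightarrow> (nat \<Rightarrow> real) \<Rightarrow> (nat \<Rightarrow> real) \<Rightarrow> (nat \<Rightarrow> real) \<Rightarrow> datum \<Rightarrow> real" where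
  "data_val N \<epsilon> x y \<psi> (Ratio i) = ratio N \<epsilon> x y i"
| "data_val N \<epsilon> x y \<psi> (Ratio' i) = ratio' N \<epsilon> x y i"
| "data_val N \<epsilon> x y \<psi> (Edge i k) = edge N \<epsilon> x y i ! k"
| "data_val N \<epsilon> x y \<psi> (Edge' i k) = edge' N \<epsilon> x y i ! k"
| "data_val N \<epsilon> x y \<psi> (Psi j) = \<psi> j"

lemma zeta_cases:
  assumes "strict_mono_on {1..N} y" "i \<in> {1..N}"
  shows "(x i < y 1 \<and> zeta N x y i = 0) \<or> (y N \<le> x i \<and> zeta N x y i = N) \<or>
    (zeta N x y i \<in> {1..<N} \<and> y (zeta N x y i) \<le> x i \<and> x i < y (zeta N x y i + 1))"
proof (cases "x i < y 1 \<or> y N \<le> x i")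
  case True
  then show ?thesis using assms by (auto simp: zeta_def)
next
  case False
  let ?P = "\<lambda>k. k \<in> {1..<N} \<and> y k \<le> x i \<and> x i < y (k + 1)"
  define S where "S = {k \<in> {1..N}. y k \<le> x i}"
  have S: "finite S" "1 \<in> S" using False assms(2) by (auto simp: S_def)
  define k where "k = Max S"
  have k: "k \<in> S" using S Max_in unfolding k_def by blast
  have "k \<noteq> N" using k False by (auto simp: S_def)
  then have kN: "k \<in> {1..<N}" using k by (auto simp: S_def)
  have "k + 1 \<notin> S" using Max_ge[OF S(1), of "k + 1"] by (auto simp flip: k_def)
  then have Pk: "?P k" using k kN by (auto simp: S_def)
  have uniq: "l = k" if "?P l" for l
  proof (rule ccontr)
    assume "l \<noteq> k"
    then consider "l + 1 \<le> k" | "k + 1 \<le> l" by linarith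
    then show False
    proof cases
      case 1
      then have "y (l + 1) \<le> y k"
        using strict_mono_on_leD[OF assms(1), of "l + 1" k] kN that by auto
      then show False using Pk that by linarith
    next
      case 2
      then have "y (k + 1) \<le> y l"
        using strict_mono_on_leD[OF assms(1), of "k + 1" l] kN that by auto
      then show False using Pk that by linarith
    qed
  qed
  have "zeta N x y i = (THE k. ?P k)" using False assms(2) by (auto simp: zeta_def)
  also have "\<dots> = k" using Pk uniq by (rule the_equality)
  finally show ?thesis using Pk by simp
qed

lemma lower_block_eq:
  assumes "strict_mono_on {1..N} y" "i \<in> {1..N}" "j \<in> {1..N}"
  shows "lower_block N \<epsilon> x y i j = (if j \<le> zeta N x y i then exp (- (x i - y j) / \<epsilon>) else 0)"
proof -
  have "y j \<le> x i" if "j \<le> zeta N x y i"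
    using zeta_cases[OF assms(1,2), of x] that assms(2,3)
      strict_mono_on_leD[OF assms(1), of j "zeta N x y i"] by auto
  then show ?thesis by (auto simp: lower_block_def exp_kernel_def)
qed

lemma upper_block_eq:
  assumes "strict_mono_on {1..N} y" "i \<in> {1..N}" "j \<in> {1..N}"
  shows "upper_block N \<epsilon> x y i j = (if j \<le> zeta N x y i then 0 else exp (- (y j - x i) / \<epsilon>))"
proof -
  have "x i < y j" if "\<not> j \<le> zeta N x y i"
    using zeta_cases[OF assms(1,2), of x] that assms(2,3)
      strict_mono_on_leD[OF assms(1), of "zeta N x y i + 1" j] by auto
  then have "- \<bar>x i - y j\<bar> = - (y j - x i)" if "\<not> j \<le> zeta N x y i"
    using that by simp
  then show ?thesis
    by (cases "j \<le> zeta N x y i") (simp_all only: upper_block_def exp_kernel_def if_True if_False simp_thms)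
qed

end

theory Submission
  imports Defs
begin

text \<open>
  On the columns \<open>j \<le> \<zeta>(i)\<close>, row \<open>i + 1\<close> of the lower block is the multiple \<open>e\<^bsup>-(x\<^bsub>i+1\<^esub> - x\<^bsub>i\<^esub>)/\<epsilon>\<^esup>\<close> of
  row \<open>i\<close>, so only the columns \<open>\<zeta>(i) < j \<le> \<zeta>(i + 1)\<close> have to be added afresh; the upper block is
  treated symmetrically, from the last row upwards. The numbers of fresh columns telescope to
  \<open>\<zeta>(N)\<close> and \<open>N - \<zeta>(1)\<close>. Programs have no constant 0, so the iterates \<open>p\<^sub>i\<close> and \<open>q\<^sub>i\<close> that vanish
  (\<open>\<zeta>(i) = 0\<close>, resp. \<open>\<zeta>(i) = N\<close>) are never computed; as the two cases exclude each other,
  every output is still available.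
\<close>

section \<open>The dividing index and the recursions\<close>

text \<open>As \<open>y\<close> increases, the columns \<open>j\<close> with
  \<open>y j \<le> x i\<close> form an initial segment of \<open>{1..N}\<close>, and in each of the
  three cases of \<open>zeta_cases\<close> the dividing index is its length. This form is free of
  the case distinction.\<close>

lemma le_zeta_iff:
  assumes "strict_mono_on {1..N} y" "i \<in> {1..N}" "j \<in> {1..N}"
  shows "j \<le> zeta N x y i \<longleftrightarrow> y j \<le> x i"
  using zeta_cases[OF assms(1,2), of x] assms(2,3)
    strict_mono_on_leD[OF assms(1), of 1 j] strict_mono_on_leD[OF assms(1), of j N]
    strict_mono_on_leD[OF assms(1), of j "zeta N x y i"]
    strict_mono_on_leD[OF assms(1), of "zeta N x y i + 1" j]
  by (cases "j \<le> zeta N x y i") (auto simp: Suc_le_eq not_le)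

lemma zeta_le:
  assumes "strict_mono_on {1..N} y"
  shows "zeta N x y i \<le> N"
proof (cases "i \<in> {1..N}")
  case True
  then show ?thesis using zeta_cases[OF assms True, of x] by auto
qed (auto simp: zeta_def)

text \<open>Out-of-range indices give the extreme values 0 and \<open>N\<close>. In between,
  \<open>y (zeta N x y i) \<le> x i \<le> x i'\<close>, so column \<open>zeta N x y i\<close> also
  belongs to the segment of row \<open>i'\<close>. Monotonicity on all of \<open>nat\<close> lets
  the values at 0 and \<open>N + 1\<close> take part in the later telescoping.\<close>

lemma mono_zeta:
  assumes "strict_mono_on {1..N} x" "strict_mono_on {1..N} y"
  shows "mono (zeta N x y)"
proof (rule monoI)
  fix i i' :: nat
  assume le: "i \<le> i'"
  \<comment> \<open>The value 0 is a separate case because \<open>le_zeta_iff\<close> concerns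
    columns from 1 on.\<close>
  consider "i = 0" | "i' > N" | "i \<in> {1..N}" "i' \<in> {1..N}" "zeta N x y i = 0"
    | "i \<in> {1..N}" "i' \<in> {1..N}" "zeta N x y i \<in> {1..N}"
    using le zeta_le[OF assms(2), of x i] by fastforce
  then show "zeta N x y i \<le> zeta N x y i'"
  proof cases
    case 1
    then show ?thesis by (simp add: zeta_def)
  next
    case 2
    then have "zeta N x y i' = N" by (simp add: zeta_def)
    then show ?thesis using zeta_le[OF assms(2)] by simp
  next
    case 4
    have "y (zeta N x y i) \<le> x i" using le_zeta_iff[OF assms(2) 4(1,3), of x] by simp
    also have "x i \<le> x i'" using strict_mono_on_leD[OF assms(1) 4(1,2) le] .
    finally show ?thesis using le_zeta_iff[OF assms(2) 4(2,3), of x] by simp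
  qed simp
qed

section \<open>Dot products and block products as sums over column intervals\<close>

lemma iprod_slice:
  "iprod (slice u a b) (slice v a b) = (\<Sum>j\<in>{a<..b}. u j * v j)"
proof -
  have "iprod (slice u a b) (slice v a b) = (\<Sum>j\<leftarrow>[a + 1..<b + 1]. u j * v j)"
    by (simp add: iprod_def slice_def zip_map_map zip_same_conv_map o_def del: upt_Suc)
  also have "\<dots> = (\<Sum>j\<in>{a + 1..<b + 1}. u j * v j)"
    by (rule interv_sum_list_conv_sum_set_nat[unfolded atLeastLessThan_upt[symmetric] set_upt])
  also have "{a + 1..<b + 1} = {a<..b}" by auto
  finally show ?thesis .
qed

lemma iprod_eq_sum_nth:
  assumes "length us = length vs"
  shows "iprod us vs = (\<Sum>k<length us. us ! k * vs ! k)"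
  using assms
  by (induction us vs rule: list_induct2)
    (simp_all add: iprod_def sum.lessThan_Suc_shift del: sum.lessThan_Suc)

lemma mat_vec_split:
  "mat_vec N (exp_kernel \<epsilon> x y) \<psi> i =
     mat_vec N (lower_block N \<epsilon> x y) \<psi> i + mat_vec N (upper_block N \<epsilon> x y) \<psi> i"
  unfolding mat_vec_def sum.distrib[symmetric]
  by (rule sum.cong) (auto simp: lower_block_def upper_block_def)

lemma mat_vec_lower_block:
  assumes "strict_mono_on {1..N} y"
  shows "mat_vec N (lower_block N \<epsilon> x y) \<psi> i =
    (\<Sum>j\<in>{0<..zeta N x y i}. lower_block N \<epsilon> x y i j * \<psi> j)"
  unfolding mat_vec_def
  by (rule sum.mono_neutral_right) (use zeta_le[OF assms, of x i] in \<open>auto simp: lower_block_def\<close>)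

lemma mat_vec_upper_block:
  "mat_vec N (upper_block N \<epsilon> x y) \<psi> i =
    (\<Sum>j\<in>{zeta N x y i<..N}. upper_block N \<epsilon> x y i j * \<psi> j)"
  unfolding mat_vec_def
  by (rule sum.mono_neutral_right) (auto simp: upper_block_def)

section \<open>Proportional rows and the two recursions\<close>

text \<open>The exponent is a part depending on \<open>i\<close> plus a part depending on
  \<open>j\<close>, so the quotient of the two rows is the same in every column where both are
  exponentials, and column 1 may represent them all. A column \<open>j\<close> in the given range
  forces \<open>1 \<le> zeta N x y i\<close>, so the default value in \<open>ratio\<close> does not
  arise.\<close>

lemma lower_block_Suc:
  assumes "strict_mono_on {1..N} x" "strict_mono_on {1..N} y" "i \<in> {1..<N}"
    "j \<in> {0<..zeta N x y i}"
  shows "lower_block N \<epsilon> x y (i + 1) j = ratio N \<epsilon> x y i * lower_block N \<epsilon> x y i j"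
proof -
  have i: "i \<in> {1..N}" "i + 1 \<in> {1..N}" and j: "j \<in> {1..N}" "1 \<in> {1..N}"
    using assms(3,4) zeta_le[OF assms(2), of x i] by auto
  have "zeta N x y i \<le> zeta N x y (i + 1)" using monoD[OF mono_zeta[OF assms(1,2)]] by simp
  then show ?thesis
    using assms(4)
    by (simp add: ratio_def lower_block_eq[OF assms(2) i(1) j(1)] lower_block_eq[OF assms(2) i(2) j(1), simplified]
        lower_block_eq[OF assms(2) i(1) j(2), simplified] lower_block_eq[OF assms(2) i(2) j(2), simplified]
        exp_diff[symmetric] exp_add[symmetric] diff_divide_distrib)
qed

text \<open>Mirror image of \<open>lower_block_Suc\<close>: the representative column is now
  \<open>N\<close>, which lies beyond \<open>zeta N x y (i + 1)\<close> as soon as some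
  \<open>j\<close> does.\<close>

lemma upper_block_Suc:
  assumes "strict_mono_on {1..N} x" "strict_mono_on {1..N} y" "i \<in> {1..<N}"
    "j \<in> {zeta N x y (i + 1)<..N}"
  shows "upper_block N \<epsilon> x y i j = ratio' N \<epsilon> x y i * upper_block N \<epsilon> x y (i + 1) j"
proof -
  have i: "i \<in> {1..N}" "i + 1 \<in> {1..N}" and j: "j \<in> {1..N}" "N \<in> {1..N}"
    using assms(3,4) by auto
  have "zeta N x y i \<le> zeta N x y (i + 1)" using monoD[OF mono_zeta[OF assms(1,2)]] by simp
  then show ?thesis
    using assms(4)
    by (simp add: ratio'_def upper_block_eq[OF assms(2) i(1) j(1)] upper_block_eq[OF assms(2) i(2) j(1), simplified]
        upper_block_eq[OF assms(2) i(1) j(2), simplified] upper_block_eq[OF assms(2) i(2) j(2), simplified]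
        exp_diff[symmetric] exp_add[symmetric] diff_divide_distrib)
qed

lemma lower_recursion_base:
  assumes "strict_mono_on {1..N} y"
  shows "mat_vec N (lower_block N \<epsilon> x y) \<psi> 1 =
    iprod (edge N \<epsilon> x y 1) (slice \<psi> (zeta N x y (1 - 1)) (zeta N x y 1))"
proof -
  have "zeta N x y 0 = 0" by (simp add: zeta_def)
  then show ?thesis by (simp add: mat_vec_lower_block[OF assms] edge_def iprod_slice)
qed

text \<open>The support of row \<open>i + 1\<close> splits into the columns inherited from row
  \<open>i\<close> and the fresh ones of the edge vector. If nothing is inherited, the first sum is
  empty and \<open>ratio\<close> multiplies 0.\<close>

lemma lower_recursion_step:
  assumes "strict_mono_on {1..N} x" "strict_mono_on {1..N} y" "i \<in> {1..<N}"
  shows "mat_vec N (lower_block N \<epsilon> x y) \<psi> (i + 1) =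
    ratio N \<epsilon> x y i * mat_vec N (lower_block N \<epsilon> x y) \<psi> i +
    iprod (edge N \<epsilon> x y (i + 1)) (slice \<psi> (zeta N x y (i + 1 - 1)) (zeta N x y (i + 1)))"
proof -
  let ?z = "zeta N x y" and ?f = "\<lambda>j. lower_block N \<epsilon> x y (i + 1) j * \<psi> j"
  have "?z i \<le> ?z (i + 1)" using monoD[OF mono_zeta[OF assms(1,2)]] by simp
  then have "{0<..?z (i + 1)} = {0<..?z i} \<union> {?z i<..?z (i + 1)}" by auto
  then have "sum ?f {0<..?z (i + 1)} = sum ?f {0<..?z i} + sum ?f {?z i<..?z (i + 1)}"
    by (simp only:) (rule sum.union_disjoint, auto)
  also have "sum ?f {0<..?z i} = ratio N \<epsilon> x y i * mat_vec N (lower_block N \<epsilon> x y) \<psi> i"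
    unfolding mat_vec_lower_block[OF assms(2)] sum_distrib_left
    by (rule sum.cong) (use lower_block_Suc[OF assms] in \<open>simp_all add: mult.assoc\<close>)
  finally show ?thesis
    unfolding mat_vec_lower_block[OF assms(2), of _ _ _ "i + 1"] by (simp add: edge_def iprod_slice)
qed

lemma upper_recursion_base:
  "mat_vec N (upper_block N \<epsilon> x y) \<psi> N =
    iprod (edge' N \<epsilon> x y N) (slice \<psi> (zeta N x y N) (zeta N x y (N + 1)))"
proof -
  have "zeta N x y (N + 1) = N" by (simp add: zeta_def)
  then show ?thesis by (simp add: mat_vec_upper_block edge'_def iprod_slice)
qed

text \<open>Here row \<open>i\<close> inherits the columns beyond \<open>zeta N x y (i + 1)\<close>
  from the row below; the fresh ones lie between the two dividing indices.\<close>

lemma upper_recursion_step: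
  assumes "strict_mono_on {1..N} x" "strict_mono_on {1..N} y" "i \<in> {1..<N}"
  shows "mat_vec N (upper_block N \<epsilon> x y) \<psi> i =
    ratio' N \<epsilon> x y i * mat_vec N (upper_block N \<epsilon> x y) \<psi> (i + 1) +
    iprod (edge' N \<epsilon> x y i) (slice \<psi> (zeta N x y i) (zeta N x y (i + 1)))"
proof -
  let ?z = "zeta N x y" and ?f = "\<lambda>j. upper_block N \<epsilon> x y i j * \<psi> j"
  have "?z i \<le> ?z (i + 1)" using monoD[OF mono_zeta[OF assms(1,2)]] by simp
  then have "{?z i<..N} = {?z (i + 1)<..N} \<union> {?z i<..?z (i + 1)}"
    using zeta_le[OF assms(2), of x "i + 1"] by auto
  then have "sum ?f {?z i<..N} = sum ?f {?z (i + 1)<..N} + sum ?f {?z i<..?z (i + 1)}"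
    by (simp only:) (rule sum.union_disjoint, auto)
  also have "sum ?f {?z (i + 1)<..N} = ratio' N \<epsilon> x y i * mat_vec N (upper_block N \<epsilon> x y) \<psi> (i + 1)"
    unfolding mat_vec_upper_block sum_distrib_left
    by (rule sum.cong) (use upper_block_Suc[OF assms] in \<open>simp_all add: mult.assoc\<close>)
  finally show ?thesis
    unfolding mat_vec_upper_block[of _ _ _ _ _ i] by (simp add: edge'_def iprod_slice)
qed

section \<open>Straight-line programs\<close>

text \<open>Well-formedness without outputs, since programs are grown instruction by instruction and
  outputs are selected only at the end.\<close>

definition wf_code :: "'v set \<Rightarrow> 'v instr list \<Rightarrow> bool" where
  "wf_code V cs \<longleftrightarrow> (\<forall>m < length cs. operands (cs ! m) \<subseteq> Input ` V \<union> Reg ` {..<m})"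

lemma registers_Nil [simp]: "registers inp [] = []"
  by (simp add: registers_def)

lemma registers_snoc [simp]:
  "registers inp (cs @ [c]) = registers inp cs @ [instr_val inp (registers inp cs) c]"
  by (simp add: registers_def)

lemma length_registers [simp]: "length (registers inp cs) = length cs"
  by (induction cs rule: rev_induct) simp_all

lemma wf_code_snoc [simp]:
  "wf_code V (cs @ [c]) \<longleftrightarrow>
     wf_code V cs \<and> operands c \<subseteq> Input ` V \<union> Reg ` {..<length cs}"
  by (auto simp: wf_code_def nth_append less_Suc_eq)

lemma operand_val_append:
  assumes "opd \<in> Input ` V \<union> Reg ` {..<length regs}"
  shows "operand_val inp (regs @ regs') opd = operand_val inp regs opd"
  using assms by (auto simp: nth_append)

text \<open>A single code makes every function in \<open>F\<close> available, within a budget of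
  \<open>m\<close> multiplications and \<open>a\<close> additions. Intermediate results are thus
  shared, and the operand for \<open>f\<close> is fixed before the input is known.\<close>

definition slp_computes ::
    "'v set \<Rightarrow> nat \<Rightarrow> nat \<Rightarrow> (('v \<Rightarrow> real) \<Rightarrow> real) set \<Rightarrow> bool" where
  "slp_computes V m a F \<longleftrightarrow>
     (\<exists>cs. wf_code V cs \<and> length (filter is_Mult cs) \<le> m \<and> length (filter is_Add cs) \<le> a \<and>
        (\<forall>f\<in>F. \<exists>opd \<in> Input ` V \<union> Reg ` {..<length cs}.
           \<forall>inp. operand_val inp (registers inp cs) opd = f inp))"

lemma slp_computes_inputs: "slp_computes V 0 0 ((\<lambda>v inp. inp v) ` V)"
  unfolding slp_computes_def by (rule exI[of _ "[]"]) (auto simp: wf_code_def)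

lemma slp_computes_mono:
  assumes "slp_computes V m a F" "m \<le> m'" "a \<le> a'" "F' \<subseteq> F"
  shows "slp_computes V m' a' F'"
proof -
  from assms(1) obtain cs where "wf_code V cs" "length (filter is_Mult cs) \<le> m"
    "length (filter is_Add cs) \<le> a"
    and F: "\<And>f. f \<in> F \<Longrightarrow> \<exists>opd \<in> Input ` V \<union> Reg ` {..<length cs}.
           \<forall>inp. operand_val inp (registers inp cs) opd = f inp"
    unfolding slp_computes_def by blast
  then have "wf_code V cs" "length (filter is_Mult cs) \<le> m'" "length (filter is_Add cs) \<le> a'"
    using assms(2,3) by simp_all
  moreover have "\<forall>f\<in>F'. \<exists>opd \<in> Input ` V \<union> Reg ` {..<length cs}.
           \<forall>inp. operand_val inp (registers inp cs) opd = f inp"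
    by (intro ballI F subsetD[OF assms(4)])
  ultimately show ?thesis unfolding slp_computes_def by (intro exI[of _ cs] conjI)
qed

text \<open>One instruction is appended; its value sits in register \<open>length cs\<close>, and
  earlier operands keep their values by \<open>operand_val_append\<close>. The fact
  \<open>extend\<close> treats both kinds of instruction at once.\<close>

lemma slp_computes_instr:
  assumes "slp_computes V m a F" "f \<in> F" "g \<in> F"
  shows slp_computes_mult: "slp_computes V (m + 1) a (insert (\<lambda>inp. f inp * g inp) F)"
    and slp_computes_add: "slp_computes V m (a + 1) (insert (\<lambda>inp. f inp + g inp) F)"
proof -
  from assms(1) obtain cs where cs: "wf_code V cs" "length (filter is_Mult cs) \<le> m"
    "length (filter is_Add cs) \<le> a"
    and F: "\<And>f. f \<in> F \<Longrightarrow> \<exists>opd \<in> Input ` V \<union> Reg ` {..<length cs}.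
           \<forall>inp. operand_val inp (registers inp cs) opd = f inp"
    unfolding slp_computes_def by blast
  obtain s where s: "s \<in> Input ` V \<union> Reg ` {..<length cs}"
    "\<And>inp. operand_val inp (registers inp cs) s = f inp" using F[OF assms(2)] by blast
  obtain t where t: "t \<in> Input ` V \<union> Reg ` {..<length cs}"
    "\<And>inp. operand_val inp (registers inp cs) t = g inp" using F[OF assms(3)] by blast
  have extend: "slp_computes V m' a' (insert h F)"
    if h: "\<And>inp. instr_val inp (registers inp cs) c = h inp" and "operands c = {s, t}"
      and "length (filter is_Mult (cs @ [c])) \<le> m'" "length (filter is_Add (cs @ [c])) \<le> a'"
    for c h m' a'
    unfolding slp_computes_def
  proof (intro exI[of _ "cs @ [c]"] conjI ballI)
    show "wf_code V (cs @ [c])" using cs(1) s(1) t(1) that(2) by simp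
    fix k assume k: "k \<in> insert h F"
    show "\<exists>opd \<in> Input ` V \<union> Reg ` {..<length (cs @ [c])}.
      \<forall>inp. operand_val inp (registers inp (cs @ [c])) opd = k inp"
    proof (cases "k = h")
      case True
      then have "\<forall>inp. operand_val inp (registers inp (cs @ [c])) (Reg (length cs)) = k inp"
        by (simp add: h nth_append)
      then show ?thesis by (rule bexI) simp
    next
      case False
      then have "k \<in> F" using k by simp
      from F[OF this] obtain opd where opd: "opd \<in> Input ` V \<union> Reg ` {..<length cs}"
        "\<forall>inp. operand_val inp (registers inp cs) opd = k inp" by (rule bexE)
      have "\<forall>inp. operand_val inp (registers inp (cs @ [c])) opd = k inp"
        using operand_val_append[of opd V "registers inp cs" inp for inp] opd by simp
      then show ?thesis by (rule bexI) (use opd(1) in auto)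
    qed
  qed (use that in simp_all)
  show "slp_computes V (m + 1) a (insert (\<lambda>inp. f inp * g inp) F)"
    by (rule extend[of "Mult s t"]) (use cs s t in simp_all)
  show "slp_computes V m (a + 1) (insert (\<lambda>inp. f inp + g inp) F)"
    by (rule extend[of "Add s t"]) (use cs s t in simp_all)
qed

text \<open>Each function is assigned one operand by choice, uniformly in the input. Outputs are
  operands, so listing them costs no instruction.\<close>

lemma slp_computes_imp_slp:
  assumes "slp_computes V m a F" "set fs \<subseteq> F"
  shows "\<exists>P. wf_slp V P \<and> num_mults P \<le> m \<and> num_adds P \<le> a \<and>
    (\<forall>inp. slp_result inp P = map (\<lambda>f. f inp) fs)"
proof -
  from assms(1) obtain cs where cs: "wf_code V cs" "length (filter is_Mult cs) \<le> m"
    "length (filter is_Add cs) \<le> a"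
    and F: "\<forall>f\<in>F. \<exists>opd \<in> Input ` V \<union> Reg ` {..<length cs}.
           \<forall>inp. operand_val inp (registers inp cs) opd = f inp"
    unfolding slp_computes_def by blast
  from bchoice[OF F[unfolded Bex_def]] obtain d where
    "\<forall>f\<in>F. d f \<in> Input ` V \<union> Reg ` {..<length cs} \<and>
      (\<forall>inp. operand_val inp (registers inp cs) (d f) = f inp)" ..
  then have d: "d f \<in> Input ` V \<union> Reg ` {..<length cs}"
    "operand_val inp (registers inp cs) (d f) = f inp" if "f \<in> F" for f inp
    using that by simp_all
  have "d ` set fs \<subseteq> Input ` V \<union> Reg ` {..<length cs}"
    using assms(2) by (intro image_subsetI) (rule d(1), erule subsetD)
  moreover have "slp_result inp (SLP cs (map d fs)) = map (\<lambda>f. f inp) fs" for inp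
    using subsetD[OF assms(2)] by (simp add: slp_result_def d(2))
  ultimately show ?thesis
    using cs
    by (intro exI[of _ "SLP cs (map d fs)"])
      (simp add: wf_slp_def wf_code_def num_mults_def num_adds_def)
qed

section \<open>Cost of dot products and of linear recursions\<close>

text \<open>With \<open>g\<close> as the initial accumulator, each term costs one product and one
  addition, and an empty dot product costs nothing.\<close>

lemma slp_computes_add_dot:
  assumes "slp_computes V m a F" "g \<in> F" "\<And>k. k < n \<Longrightarrow> u k \<in> F \<and> v k \<in> F"
  shows "slp_computes V (m + n) (a + n) (insert (\<lambda>inp. g inp + (\<Sum>k<n. u k inp * v k inp)) F)"
  using assms(3)
proof (induction n)
  case 0
  then show ?case using assms(1,2) by (simp add: insert_absorb)
next
  case (Suc n)
  let ?s = "\<lambda>inp. g inp + (\<Sum>k<n. u k inp * v k inp)" and ?t = "\<lambda>inp. u n inp * v n inp"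
  have "slp_computes V (m + n) (a + n) (insert ?s F)" using Suc by simp
  then have "slp_computes V (m + n + 1) (a + n) (insert ?t (insert ?s F))"
    by (rule slp_computes_mult) (use Suc.prems in auto)
  then have "slp_computes V (m + n + 1) (a + n + 1)
      (insert (\<lambda>inp. ?s inp + ?t inp) (insert ?t (insert ?s F)))"
    by (rule slp_computes_add) auto
  then show ?case by (rule slp_computes_mono) (auto simp: add.assoc)
qed

text \<open>The first product serves as the accumulator, which saves one addition. This requires a
  nonempty vector, as no register holding 0 is at hand.\<close>

lemma slp_computes_dot:
  assumes "slp_computes V m a F" "0 < n" "\<And>k. k < n \<Longrightarrow> u k \<in> F \<and> v k \<in> F"
  shows "slp_computes V (m + n) (a + (n - 1)) (insert (\<lambda>inp. \<Sum>k<n. u k inp * v k inp) F)"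
proof -
  obtain l where l: "n = Suc l" using assms(2) by (cases n) auto
  let ?g = "\<lambda>inp. u 0 inp * v 0 inp"
  have "slp_computes V (m + 1) a (insert ?g F)"
    by (rule slp_computes_mult) (use assms in auto)
  then have "slp_computes V (m + 1 + l) (a + l)
     (insert (\<lambda>inp. ?g inp + (\<Sum>k<l. u (Suc k) inp * v (Suc k) inp)) (insert ?g F))"
    by (rule slp_computes_add_dot) (use assms(3) l in auto)
  then show ?thesis
    by (rule slp_computes_mono) (auto simp: l sum.lessThan_Suc_shift simp del: sum.lessThan_Suc)
qed

text \<open>
  While the total number of edge entries is still zero, the iterate vanishes and costs nothing. The
  first nonempty edge vector then saves one addition, which is the truncated \<open>- 1\<close> below.
\<close>

lemma slp_computes_recursion:
  assumes "slp_computes V m a F"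
    and c: "\<And>i. 0 < i \<Longrightarrow> i < N \<Longrightarrow> c i \<in> F"
    and uv: "\<And>i k. i < N \<Longrightarrow> k < n i \<Longrightarrow> u i k \<in> F \<and> v i k \<in> F"
    and s0: "s 0 = (\<lambda>inp. 0)"
    and sSuc: "\<And>i. i < N \<Longrightarrow>
      s (Suc i) = (\<lambda>inp. c i inp * s i inp + (\<Sum>k<n i. u i k inp * v i k inp))"
    and T: "\<And>i. i \<le> N \<Longrightarrow> T i = (\<Sum>l<i. n l)"
  shows "slp_computes V (m + T N + (N - 1)) (a + (T N - 1)) (F \<union> s ` {i \<in> {..N}. 0 < T i})"
    and "\<And>i. i \<le> N \<Longrightarrow> T i = 0 \<Longrightarrow> s i = (\<lambda>inp. 0)"
proof -
  have T_Suc: "T (Suc i) = T i + n i" if "i < N" for i using T that by simp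
  have zero: "s i = (\<lambda>inp. 0)" if "i \<le> N" "T i = 0" for i
    using that by (induction i) (auto simp: s0 sSuc T_Suc Suc_le_eq)
  then show "\<And>i. i \<le> N \<Longrightarrow> T i = 0 \<Longrightarrow> s i = (\<lambda>inp. 0)" .
  have "slp_computes V (m + T j + (j - 1)) (a + (T j - 1)) (F \<union> s ` {i \<in> {..j}. 0 < T i})"
    if "j \<le> N" for j
    using that
  proof (induction j)
    case 0
    have "T 0 = 0" using T by simp
    then show ?case by (intro slp_computes_mono[OF assms(1)]) auto
  next
    case (Suc j)
    let ?F = "F \<union> s ` {i \<in> {..j}. 0 < T i}"
    let ?F' = "F \<union> s ` {i \<in> {..Suc j}. 0 < T i}"
    let ?dot = "\<lambda>inp. \<Sum>k<n j. u j k inp * v j k inp"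
    have j: "j < N" using Suc.prems by simp
    have IH: "slp_computes V (m + T j + (j - 1)) (a + (T j - 1)) ?F" using Suc by simp
    have F': "?F' \<subseteq> insert (s (Suc j)) ?F" by (auto simp: le_Suc_eq)
    consider "0 < T j" | "T j = 0" "n j = 0" | "T j = 0" "0 < n j" by blast
    then show ?case
    proof cases
      case 1
      \<comment> \<open>Since \<open>T 0 = 0\<close>, step 0 cannot fall into this case. Hence
        \<open>c j\<close> is available, and its product raises the budget from \<open>j - 1\<close>
        to \<open>Suc j - 1\<close>.\<close>
      then have "0 < j" using T[of 0] by (cases j) auto
      let ?g = "\<lambda>inp. c j inp * s j inp"
      have "slp_computes V (m + T j + (j - 1) + 1) (a + (T j - 1)) (insert ?g ?F)"
        using IH by (rule slp_computes_mult) (use c[OF \<open>0 < j\<close> j] 1 in auto)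
      then have "slp_computes V (m + T j + (j - 1) + 1 + n j) (a + (T j - 1) + n j)
          (insert (\<lambda>inp. ?g inp + ?dot inp) (insert ?g ?F))"
        by (rule slp_computes_add_dot) (use uv[OF j] in auto)
      then show ?thesis
        by (rule slp_computes_mono) (use 1 \<open>0 < j\<close> F' in \<open>auto simp: T_Suc[OF j] sSuc[OF j]\<close>)
    next
      case 2
      \<comment> \<open>Now \<open>T (Suc j) = 0\<close>, so the new iterate is not among the
        functions to be provided.\<close>
      then have "?F' \<subseteq> ?F" by (auto simp: le_Suc_eq T_Suc[OF j])
      then show ?thesis
        by (intro slp_computes_mono[OF IH]) (use 2 in \<open>auto simp: T_Suc[OF j]\<close>)
    next
      case 3
      \<comment> \<open>The previous iterate is zero, so neither the multiplication by
        \<open>c j\<close> nor the addition to it is performed.\<close>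
      have "s (Suc j) = ?dot" using zero[of j] 3 j by (simp add: sSuc)
      moreover have "slp_computes V (m + T j + (j - 1) + n j) (a + (T j - 1) + (n j - 1))
          (insert ?dot ?F)"
        using IH by (rule slp_computes_dot) (use uv[OF j] 3 in auto)
      ultimately show ?thesis
        by (elim slp_computes_mono) (use 3 F' in \<open>auto simp: T_Suc[OF j]\<close>)
    qed
  qed
  then show "slp_computes V (m + T N + (N - 1)) (a + (T N - 1)) (F \<union> s ` {i \<in> {..N}. 0 < T i})"
    by simp
qed

lemma slp_computes_sums:
  assumes "slp_computes V m a F" "finite I" "\<And>i. i \<in> I \<Longrightarrow> f i \<in> F \<and> g i \<in> F"
  shows "slp_computes V m (a + card I) (F \<union> (\<lambda>i inp. f i inp + g i inp) ` I)"
  using assms(2,3)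
proof (induction I)
  case empty
  then show ?case using assms(1) by simp
next
  case (insert i I)
  have "slp_computes V m (a + card I + 1)
      (insert (\<lambda>inp. f i inp + g i inp) (F \<union> (\<lambda>i inp. f i inp + g i inp) ` I))"
    by (rule slp_computes_add) (use insert in auto)
  then show ?case using insert by simp
qed

section \<open>The program for the matrix-vector product\<close>

text \<open>The forward recursion over arbitrary input values, so that a program can be built from
  \<open>z\<close> alone. Starting at index 0 with value 0 lets row 1 follow the common rule;
  \<open>Ratio 0\<close>, which is not a datum, only multiplies 0 there.\<close>

primrec lower_iter :: "(nat \<Rightarrow> nat) \<Rightarrow> (datum \<Rightarrow> real) \<Rightarrow> nat \<Rightarrow> real" where
  "lower_iter z inp 0 = 0"
| "lower_iter z inp (Suc i) = inp (Ratio i) * lower_iter z inp i +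
     (\<Sum>k<z (Suc i) - z i. inp (Edge (Suc i) k) * inp (Psi (z i + 1 + k)))"

text \<open>The backward recursion runs from row \<open>N\<close> upwards: step \<open>l\<close> produces row \<open>N + 1 - l\<close>.\<close>

primrec upper_iter :: "nat \<Rightarrow> (nat \<Rightarrow> nat) \<Rightarrow> (datum \<Rightarrow> real) \<Rightarrow> nat \<Rightarrow> real" where
  "upper_iter N z inp 0 = 0"
| "upper_iter N z inp (Suc l) = inp (Ratio' (N - l)) * upper_iter N z inp l +
     (\<Sum>k<z (N - l + 1) - z (N - l). inp (Edge' (N - l) k) * inp (Psi (z (N - l) + 1 + k)))"

lemma lower_iter_eq:
  assumes "strict_mono_on {1..N} x" "strict_mono_on {1..N} y" "i \<in> {1..N}"
  shows "lower_iter (zeta N x y) (data_val N \<epsilon> x y \<psi>) i = mat_vec N (lower_block N \<epsilon> x y) \<psi> i"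
proof -
  \<comment> \<open>Position \<open>k\<close> of the edge vector belongs to column
    \<open>zeta N x y i + 1 + k\<close>.\<close>
  have dot: "(\<Sum>k<zeta N x y (Suc i) - zeta N x y i.
        data_val N \<epsilon> x y \<psi> (Edge (Suc i) k) * data_val N \<epsilon> x y \<psi> (Psi (zeta N x y i + 1 + k)))
      = iprod (edge N \<epsilon> x y (Suc i)) (slice \<psi> (zeta N x y i) (zeta N x y (Suc i)))" for i
    by (subst iprod_eq_sum_nth) (auto simp: edge_def slice_def simp del: upt_Suc intro!: sum.cong)
  have "1 \<le> i" "i \<le> N" using assms(3) by auto
  then show ?thesis
  proof (induction i rule: dec_induct)
    case base
    show ?case using dot[of 0] lower_recursion_base[OF assms(2), of \<epsilon> x \<psi>] by simp
  next
    case (step i)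
    then show ?case using dot[of i] lower_recursion_step[OF assms(1,2), of i \<epsilon> \<psi>] by simp
  qed
qed

text \<open>Downward induction on the row, because step \<open>N + 1 - i\<close> of the backward
  iteration yields row \<open>i\<close>.\<close>

lemma upper_iter_eq:
  assumes "strict_mono_on {1..N} x" "strict_mono_on {1..N} y" "i \<in> {1..N}"
  shows "upper_iter N (zeta N x y) (data_val N \<epsilon> x y \<psi>) (N + 1 - i) =
    mat_vec N (upper_block N \<epsilon> x y) \<psi> i"
proof -
  have dot: "(\<Sum>k<zeta N x y (i + 1) - zeta N x y i.
        data_val N \<epsilon> x y \<psi> (Edge' i k) * data_val N \<epsilon> x y \<psi> (Psi (zeta N x y i + 1 + k)))
      = iprod (edge' N \<epsilon> x y i) (slice \<psi> (zeta N x y i) (zeta N x y (i + 1)))" for i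
    by (subst iprod_eq_sum_nth) (auto simp: edge'_def slice_def simp del: upt_Suc intro!: sum.cong)
  have "i \<le> N" "1 \<le> i" using assms(3) by auto
  then show ?thesis
  proof (induction i rule: inc_induct)
    case base
    show ?case using dot[of N] upper_recursion_base[of N \<epsilon> x y \<psi>] by simp
  next
    case (step i)
    have "N + 1 - i = Suc (N - i)" "N - (N - i) = i" "N + 1 - Suc i = N - i" using step by auto
    then show ?case
      using step dot[of i] upper_recursion_step[OF assms(1,2), of i \<epsilon> \<psi>] by simp
  qed
qed

section \<open>Assembly of the program and its operation count\<close>

text \<open>The index map \<open>z\<close> is abstract because the program may depend on
  \<open>N\<close> and the dividing index only. The forward recursion is followed by the backward
  one and then by the sums of the two iterates.\<close>

lemma exists_slp:
  assumes "1 \<le> N" "mono z" "z 0 = 0" "z (N + 1) = N"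
  shows "\<exists>P. wf_slp (data N z) P \<and>
    num_mults P \<le> 3 * N + z N - z 1 - 2 \<and> num_adds P \<le> 2 * N + z N - z 1 - 2 \<and>
    (\<forall>inp. slp_result inp P =
       map (\<lambda>i. lower_iter z inp i + upper_iter N z inp (N + 1 - i)) [1..<N + 1])"
proof -
  define p where "p = (\<lambda>i inp. lower_iter z inp i)"
  define q where "q = (\<lambda>l inp. upper_iter N z inp l)"
  let ?V = "data N z"
  define F0 where "F0 = (\<lambda>v (inp :: datum \<Rightarrow> real). inp v) ` ?V"
  have z_mono: "z i \<le> z j" if "i \<le> j" for i j using monoD[OF assms(2)] that .
  have z_le: "z i \<le> N" if "i \<le> N + 1" for i using z_mono[OF that] assms(4) by simp
  have F0: "(\<lambda>inp. inp v) \<in> F0" if "v \<in> ?V" for v using that by (auto simp: F0_def)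
  have start: "slp_computes ?V 0 0 F0" unfolding F0_def by (rule slp_computes_inputs)
  have T_lower: "z i = (\<Sum>l<i. z (Suc l) - z l)" for i
  proof (induction i)
    case (Suc i)
    have "z i \<le> z (Suc i)" by (rule z_mono) simp
    then show ?case unfolding sum.lessThan_Suc Suc.IH[symmetric] by simp
  qed (simp add: assms(3))
  \<comment> \<open>Telescoping downwards from \<open>z (N + 1) = N\<close>: after \<open>l\<close>
    backward steps, exactly the columns beyond \<open>z (N + 1 - l)\<close> have entered.\<close>
  have T_upper: "N - z (N + 1 - l) = (\<Sum>l<l. z (N - l + 1) - z (N - l))" if "l \<le> N" for l
    using that
  proof (induction l)
    case 0
    then show ?case by (simp add: assms(4)[simplified])
  next
    case (Suc l)
    have "N + 1 - l = N - l + 1" "N + 1 - Suc l = N - l" using Suc.prems by auto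
    then show ?case
      unfolding sum.lessThan_Suc Suc.IH[OF Suc_leD[OF Suc.prems], symmetric]
      using z_mono[of "N - l" "N - l + 1"] z_le[of "N - l + 1"] by simp
  qed
  let ?Fp = "F0 \<union> p ` {i \<in> {..N}. 0 < z i}"
  have V_lower: "Edge (Suc i) k \<in> ?V" "Psi (z i + 1 + k) \<in> ?V" if "i < N" "k < z (Suc i) - z i" for i k
    using that z_le[of "Suc i"] by (auto simp: data_def)
  have V_upper: "Edge' i k \<in> ?V" "Psi (z i + 1 + k) \<in> ?V"
    if "i \<in> {1..N}" "k < z (i + 1) - z i" for i k
    using that z_le[of "i + 1"] by (auto simp: data_def)
  have lower_c: "(\<lambda>inp. inp (Ratio i)) \<in> F0" if "0 < i" "i < N" for i
    by (rule F0) (use that in \<open>simp add: data_def\<close>)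
  have lower_uv: "(\<lambda>inp. inp (Edge (Suc i) k)) \<in> F0 \<and> (\<lambda>inp. inp (Psi (z i + 1 + k))) \<in> F0"
    if "i < N" "k < z (Suc i) - z i" for i k
    by (intro conjI F0 V_lower that)
  have p_0: "p 0 = (\<lambda>inp. 0)" by (simp add: p_def)
  have p_Suc: "p (Suc i) = (\<lambda>inp. inp (Ratio i) * p i inp +
      (\<Sum>k<z (Suc i) - z i. inp (Edge (Suc i) k) * inp (Psi (z i + 1 + k))))" for i
    by (simp add: p_def)
  note lower = slp_computes_recursion[OF start, where N = N and s = p and T = z
      and c = "\<lambda>i inp. inp (Ratio i)" and n = "\<lambda>i. z (Suc i) - z i"
      and u = "\<lambda>i k inp. inp (Edge (Suc i) k)" and v = "\<lambda>i k inp. inp (Psi (z i + 1 + k))",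
      OF lower_c lower_uv p_0 p_Suc T_lower]
  have Fp: "slp_computes ?V (z N + (N - 1)) (z N - 1) ?Fp" using lower(1) by simp
  note p0 = lower(2)
  define F where "F = ?Fp \<union> q ` {l \<in> {..N}. 0 < N - z (N + 1 - l)}"
  have upper_c: "(\<lambda>inp. inp (Ratio' (N - l))) \<in> ?Fp" if "0 < l" "l < N" for l
    by (intro UnI1 F0) (use that in \<open>simp add: data_def\<close>)
  have upper_uv: "(\<lambda>inp. inp (Edge' (N - l) k)) \<in> ?Fp \<and>
      (\<lambda>inp. inp (Psi (z (N - l) + 1 + k))) \<in> ?Fp"
    if "l < N" "k < z (N - l + 1) - z (N - l)" for l k
    by (intro conjI UnI1 F0 V_upper that(2)) (use that(1) in simp_all)
  have q_0: "q 0 = (\<lambda>inp. 0)" by (simp add: q_def)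
  have q_Suc: "q (Suc l) = (\<lambda>inp. inp (Ratio' (N - l)) * q l inp +
      (\<Sum>k<z (N - l + 1) - z (N - l). inp (Edge' (N - l) k) * inp (Psi (z (N - l) + 1 + k))))" for l
    by (simp add: q_def)
  \<comment> \<open>Starting from \<open>?Fp\<close> keeps the forward iterates available and adds
    the two costs.\<close>
  note upper = slp_computes_recursion[OF Fp, where N = N and s = q and T = "\<lambda>l. N - z (N + 1 - l)"
      and c = "\<lambda>l inp. inp (Ratio' (N - l))" and n = "\<lambda>l. z (N - l + 1) - z (N - l)"
      and u = "\<lambda>l k inp. inp (Edge' (N - l) k)" and v = "\<lambda>l k inp. inp (Psi (z (N - l) + 1 + k))",
      OF upper_c upper_uv q_0 q_Suc T_upper]
  have F: "slp_computes ?V (z N + (N - 1) + (N - z 1) + (N - 1)) (z N - 1 + (N - z 1 - 1)) F"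
    unfolding F_def using upper(1) by simp
  note q0 = upper(2)
  \<comment> \<open>Only in these rows are both iterates computed, so only these need a final
    addition; in every other row one iterate is identically 0 and the other is the output.\<close>
  define I where "I = {i \<in> {1..N}. 0 < z i \<and> z i < N}"
  let ?r = "\<lambda>i inp. p i inp + q (N + 1 - i) inp"
  have pF: "p i \<in> F" if "i \<in> {1..N}" "0 < z i" for i using that by (auto simp: F_def)
  have qF: "q (N + 1 - i) \<in> F" if "i \<in> {1..N}" "z i < N" for i
    using that unfolding F_def by (intro UnI2 imageI) auto
  have "finite I" "\<And>i. i \<in> I \<Longrightarrow> p i \<in> F \<and> q (N + 1 - i) \<in> F"
    using pF qF by (auto simp: I_def)
  note R = slp_computes_sums[OF F this]
  have r: "?r i \<in> F \<union> ?r ` I" if i: "i \<in> {1..N}" for i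
  proof -
    consider "z i = 0" | "z i = N" "z i \<noteq> 0" | "i \<in> I" using i z_le[of i] by (fastforce simp: I_def)
    then show ?thesis
    proof cases
      case 1
      then have "?r i = q (N + 1 - i)" using p0[of i] i by simp
      then show ?thesis using qF[of i] 1 i assms(1) by simp
    next
      case 2
      have "q (N + 1 - i) = (\<lambda>inp. 0)" by (rule q0) (use 2 i in auto)
      then have "?r i = p i" by simp
      then show ?thesis using pF[of i] 2 i by simp
    qed auto
  qed
  \<comment> \<open>In general \<open>card I \<le> N\<close> suffices. If \<open>z N = 0\<close> or
    \<open>z 1 = N\<close>, a truncated \<open>- 1\<close> is lost, but then \<open>I\<close> is
    empty, which compensates.\<close>
  have "card I \<le> card {1..N}" by (rule card_mono) (auto simp: I_def)
  moreover have "I = {}" if "z N = 0" using z_mono[of _ N] that by (fastforce simp: I_def)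
  moreover have "I = {}" if "z 1 = N" using z_mono[of 1] that by (fastforce simp: I_def)
  moreover have "z 1 \<le> z N" "z N \<le> N" "z 1 \<le> N" using z_mono[of 1 N] z_le assms(1) by auto
  ultimately have adds: "z N - 1 + (N - z 1 - 1) + card I \<le> 2 * N + z N - z 1 - 2"
    using assms(1) by (cases "z N = 0"; cases "z 1 = N") auto
  have mults: "z N + (N - 1) + (N - z 1) + (N - 1) \<le> 3 * N + z N - z 1 - 2"
    using \<open>z 1 \<le> N\<close> assms(1) by simp
  have "set (map ?r [1..<N + 1]) = ?r ` {1..N}"
    by (simp only: set_map set_upt Suc_eq_plus1[symmetric] atLeastLessThanSuc_atLeastAtMost)
  then have "set (map ?r [1..<N + 1]) \<subseteq> F \<union> ?r ` I"
    by (simp only:) (intro image_subsetI r)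
  from slp_computes_imp_slp[OF slp_computes_mono[OF R mults adds order_refl] this]
  show ?thesis by (simp add: p_def q_def o_def del: upt_Suc)
qed

section \<open>Uniform choice of the program and the linear bound\<close>

theorem mainTheorem3:
  shows
    "(\<forall>(N::nat) (\<epsilon>::real) (x::nat \<Rightarrow> real) (y::nat \<Rightarrow> real) (\<psi>::nat \<Rightarrow> real).
        N \<ge> 1 \<longrightarrow> \<epsilon> > 0 \<longrightarrow> strict_mono_on {1..N} x \<longrightarrow> strict_mono_on {1..N} y \<longrightarrow>
        (let \<zeta> = zeta N x y;
             p = mat_vec N (lower_block N \<epsilon> x y) \<psi>;
             q = mat_vec N (upper_block N \<epsilon> x y) \<psi>;
             \<eta> = edge N \<epsilon> x y; \<eta>' = edge' N \<epsilon> x y;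
             r = ratio N \<epsilon> x y; r' = ratio' N \<epsilon> x y;
             \<psi>s = (\<lambda>i. slice \<psi> (\<zeta> (i - 1)) (\<zeta> i));
             \<psi>s' = (\<lambda>i. slice \<psi> (\<zeta> i) (\<zeta> (i + 1)))
         in (\<forall>i\<in>{1..N}. mat_vec N (exp_kernel \<epsilon> x y) \<psi> i = p i + q i) \<and>
            p 1 = iprod (\<eta> 1) (\<psi>s 1) \<and>
            (\<forall>i\<in>{1..<N}. p (i + 1) = r i * p i + iprod (\<eta> (i + 1)) (\<psi>s (i + 1))) \<and>
            q N = iprod (\<eta>' N) (\<psi>s' N) \<and>
            (\<forall>i\<in>{1..<N}. q i = r' i * q (i + 1) + iprod (\<eta>' i) (\<psi>s' i))))
     \<and>
     (\<exists>prog :: nat \<Rightarrow> (nat \<Rightarrow> nat) \<Rightarrow> datum slp.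
        (\<forall>(N::nat) (x::nat \<Rightarrow> real) (y::nat \<Rightarrow> real).
           N \<ge> 1 \<longrightarrow> strict_mono_on {1..N} x \<longrightarrow> strict_mono_on {1..N} y \<longrightarrow>
           (let \<zeta> = zeta N x y; P = prog N \<zeta>
            in wf_slp (data N \<zeta>) P \<and>
               (\<forall>\<epsilon>>0. \<forall>\<psi>. slp_result (data_val N \<epsilon> x y \<psi>) P
                            = map (mat_vec N (exp_kernel \<epsilon> x y) \<psi>) [1..<N + 1]) \<and>
               int (num_mults P) \<le> 3 * int N + int (\<zeta> N) - int (\<zeta> 1) - 2 \<and>
               3 * int N + int (\<zeta> N) - int (\<zeta> 1) - 2 < 4 * int N \<and>
               int (num_adds P) \<le> 2 * int N + int (\<zeta> N) - int (\<zeta> 1) - 2 \<and>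
               2 * int N + int (\<zeta> N) - int (\<zeta> 1) - 2 < 3 * int N)) \<and>
        (\<forall>(X::nat \<Rightarrow> nat \<Rightarrow> real) (Y::nat \<Rightarrow> nat \<Rightarrow> real).
           (\<forall>N\<ge>1. strict_mono_on {1..N} (X N) \<and> strict_mono_on {1..N} (Y N)) \<longrightarrow>
           (\<lambda>N. real (num_mults (prog N (zeta N (X N) (Y N))) + num_adds (prog N (zeta N (X N) (Y N)))))
             \<in> O(\<lambda>N. real N)))"
proof -
  \<comment> \<open>These properties mention \<open>N\<close>, \<open>z\<close> and arbitrary inputs
    only, so choosing a program by them makes it independent of \<epsilon>, \<psi> and the points
    except through the dividing index.\<close>
  define good where "good = (\<lambda>N z P. wf_slp (data N z) P \<and>
    num_mults P \<le> 3 * N + z N - z 1 - 2 \<and> num_adds P \<le> 2 * N + z N - z 1 - 2 \<and>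
    (\<forall>inp. slp_result inp P =
       map (\<lambda>i. lower_iter z inp i + upper_iter N z inp (N + 1 - i)) [1..<N + 1]))"
  define prog where "prog = (\<lambda>N z. SOME P. good N z P)"
  have prog: "good N (zeta N x y) (prog N (zeta N x y))"
    if "1 \<le> N" "strict_mono_on {1..N} x" "strict_mono_on {1..N} y" for N x y
  proof -
    have "zeta N x y 0 = 0" "zeta N x y (N + 1) = N" by (auto simp: zeta_def)
    from exists_slp[OF that(1) mono_zeta[OF that(2,3)] this] show ?thesis
      unfolding prog_def good_def by (rule someI_ex)
  qed
  have bounds: "zeta N x y 1 \<le> zeta N x y N" "zeta N x y N \<le> N"
    if "1 \<le> N" "strict_mono_on {1..N} x" "strict_mono_on {1..N} y" for N x y
    using monoD[OF mono_zeta[OF that(2,3)] that(1)] zeta_le[OF that(3)] by auto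
  have result: "slp_result (data_val N \<epsilon> x y \<psi>) (prog N (zeta N x y)) =
      map (mat_vec N (exp_kernel \<epsilon> x y) \<psi>) [1..<N + 1]"
    if "1 \<le> N" "strict_mono_on {1..N} x" "strict_mono_on {1..N} y" for N \<epsilon> x y \<psi>
  proof -
    have "slp_result (data_val N \<epsilon> x y \<psi>) (prog N (zeta N x y)) =
        map (\<lambda>i. lower_iter (zeta N x y) (data_val N \<epsilon> x y \<psi>) i +
          upper_iter N (zeta N x y) (data_val N \<epsilon> x y \<psi>) (N + 1 - i)) [1..<N + 1]"
      using prog[OF that] by (simp add: good_def del: upt_Suc)
    also have "\<dots> = map (mat_vec N (exp_kernel \<epsilon> x y) \<psi>) [1..<N + 1]"
      by (rule map_cong) (auto simp: lower_iter_eq[OF that(2,3)] upper_iter_eq[OF that(2,3), simplified]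
          mat_vec_split[of N \<epsilon> x y \<psi>] simp del: upt_Suc)
    finally show ?thesis .
  qed
  have linear: "(\<lambda>N. real (num_mults (prog N (zeta N (X N) (Y N))) +
      num_adds (prog N (zeta N (X N) (Y N))))) \<in> O(\<lambda>N. real N)"
    if "\<forall>N\<ge>1. strict_mono_on {1..N} (X N) \<and> strict_mono_on {1..N} (Y N)" for X Y
  \<comment> \<open>The constant is 4 for the multiplications plus 3 for the additions.\<close>
  proof (rule bigoI[of _ 7])
    show "\<forall>\<^sub>F N in at_top. norm (real (num_mults (prog N (zeta N (X N) (Y N))) +
      num_adds (prog N (zeta N (X N) (Y N))))) \<le> 7 * norm (real N)"
      using eventually_ge_at_top[of 1]
    proof eventually_elim
      case (elim N)
      then have "strict_mono_on {1..N} (X N)" "strict_mono_on {1..N} (Y N)" using that by auto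
      from prog[OF elim this] bounds[OF elim this]
      have "num_mults (prog N (zeta N (X N) (Y N))) + num_adds (prog N (zeta N (X N) (Y N))) \<le> 7 * N"
        unfolding good_def by linarith
      then show ?case by simp
    qed
  qed
  show ?thesis
  proof (intro conjI exI[of _ prog] allI impI)
    fix N :: nat and \<epsilon> :: real and x y \<psi> :: "nat \<Rightarrow> real"
    assume "1 \<le> N" "strict_mono_on {1..N} x" "strict_mono_on {1..N} y"
    then show "let \<zeta> = zeta N x y;
             p = mat_vec N (lower_block N \<epsilon> x y) \<psi>;
             q = mat_vec N (upper_block N \<epsilon> x y) \<psi>;
             \<eta> = edge N \<epsilon> x y; \<eta>' = edge' N \<epsilon> x y;
             r = ratio N \<epsilon> x y; r' = ratio' N \<epsilon> x y;
             \<psi>s = (\<lambda>i. slice \<psi> (\<zeta> (i - 1)) (\<zeta> i));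
             \<psi>s' = (\<lambda>i. slice \<psi> (\<zeta> i) (\<zeta> (i + 1)))
         in (\<forall>i\<in>{1..N}. mat_vec N (exp_kernel \<epsilon> x y) \<psi> i = p i + q i) \<and>
            p 1 = iprod (\<eta> 1) (\<psi>s 1) \<and>
            (\<forall>i\<in>{1..<N}. p (i + 1) = r i * p i + iprod (\<eta> (i + 1)) (\<psi>s (i + 1))) \<and>
            q N = iprod (\<eta>' N) (\<psi>s' N) \<and>
            (\<forall>i\<in>{1..<N}. q i = r' i * q (i + 1) + iprod (\<eta>' i) (\<psi>s' i))"
      unfolding Let_def
      by (intro conjI ballI mat_vec_split lower_recursion_base lower_recursion_step
          upper_recursion_base upper_recursion_step)
  next
    fix N :: nat and x y :: "nat \<Rightarrow> real"
    assume *: "1 \<le> N" "strict_mono_on {1..N} x" "strict_mono_on {1..N} y"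
    show "let \<zeta> = zeta N x y; P = prog N \<zeta>
            in wf_slp (data N \<zeta>) P \<and>
               (\<forall>\<epsilon>>0. \<forall>\<psi>. slp_result (data_val N \<epsilon> x y \<psi>) P
                            = map (mat_vec N (exp_kernel \<epsilon> x y) \<psi>) [1..<N + 1]) \<and>
               int (num_mults P) \<le> 3 * int N + int (\<zeta> N) - int (\<zeta> 1) - 2 \<and>
               3 * int N + int (\<zeta> N) - int (\<zeta> 1) - 2 < 4 * int N \<and>
               int (num_adds P) \<le> 2 * int N + int (\<zeta> N) - int (\<zeta> 1) - 2 \<and>
               2 * int N + int (\<zeta> N) - int (\<zeta> 1) - 2 < 3 * int N"
      unfolding Let_def
    proof (intro conjI allI impI result[OF *])
      show "wf_slp (data N (zeta N x y)) (prog N (zeta N x y))"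
        using prog[OF *] by (simp add: good_def)
    \<comment> \<open>By \<open>bounds\<close> and \<open>1 \<le> N\<close> the natural-number
      differences are not truncated and agree with the integer ones; strictness comes from the
      \<open>- 2\<close>.\<close>
    qed (use prog[OF *, unfolded good_def] bounds[OF *] \<open>1 \<le> N\<close> in linarith)+
  qed (rule linear)
qed

end
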